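(* Let $A, B\in\mathcal{B}(\mathcal{H})$ be positive operators. If $A\le B$, then the operator matrix on $\mathcal{H}\oplus\mathcal{H}$ $$\begin{bmatrix} \sqrt{\kappa(A^{-1},B)}\,(A\sharp B) & A\natural B\\ A\natural B & \sqrt{\kappa(A^{-1},B)}\,(A\sharp B)\end{bmatrix}\ge O .$$
   Context: $\mathcal{B}(\mathcal{H})$ is the $C^*$-algebra of bounded linear operators on a complex Hilbert space $\mathcal{H}$. "Positive" means $\langle Tx,x\rangle>0$ for all nonzero $x$ and $T$ is invertible in $\mathcal{B}(\mathcal{H})$; $T\ge O$ means $\langle Tx,x\rangle\ge0$ for all $x$, and $S\le T$ means $T-S\ge O$. For positive $A,B$: $A\sharp B:=A^{\frac12}\left(A^{-\frac12}BA^{-\frac12}\right)^{\frac12}A^{\frac12}$ and $A\natural B:=A^{\frac12}\left(B^{\frac12}A^{-1}B^{\frac12}\right)^{\frac12}A^{\frac12}$. For $S,T\in\mathcal{B}(\mathcal{H})$, $\kappa(S,T):=\|S\|\,\|T\|$ (operator norm). *)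

theory Defs
  imports "HOL-Analysis.Analysis"
begin

(* Complex inner product spaces: the underlying real normed space carries a compatible complex
   scalar multiplication and an inner product that is linear in its first argument and induces
   the norm. Definiteness and nonnegativity of the inner product follow from cinner_self. *)
class complex_inner = real_normed_vector +
  fixes scaleC :: "complex \<Rightarrow> 'a \<Rightarrow> 'a"  (infixr "*\<^sub>C" 75)
    and cinner :: "'a \<Rightarrow> 'a \<Rightarrow> complex"
  assumes scaleC_add_right: "c *\<^sub>C (x + y) = c *\<^sub>C x + c *\<^sub>C y"
    and scaleC_add_left: "(c + d) *\<^sub>C x = c *\<^sub>C x + d *\<^sub>C x"
    and scaleC_scaleC: "c *\<^sub>C (d *\<^sub>C x) = (c * d) *\<^sub>C x"
    and scaleC_of_real: "complex_of_real r *\<^sub>C x = r *\<^sub>R x"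
    and cinner_commute: "cinner x y = cnj (cinner y x)"
    and cinner_add_left: "cinner (x + y) z = cinner x z + cinner y z"
    and cinner_scaleC_left: "cinner (c *\<^sub>C x) y = c * cinner x y"
    and cinner_self: "cinner x x = complex_of_real ((norm x)\<^sup>2)"

class complex_hilbert_space = complex_inner + complete_space

instantiation complex :: complex_hilbert_space
begin

definition scaleC_complex :: "complex \<Rightarrow> complex \<Rightarrow> complex"
  where "scaleC_complex c x = c * x"

definition cinner_complex :: "complex \<Rightarrow> complex \<Rightarrow> complex"
  where "cinner_complex x y = x * cnj y"

instance
  by standard
    (simp_all add: scaleC_complex_def cinner_complex_def algebra_simps scaleR_conv_of_real
      complex_norm_square[symmetric])

end

(* The Hilbert space direct sum of two spaces is their product type; its norm in HOL-Analysis is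
   already the Euclidean one. *)
instantiation prod :: (complex_inner, complex_inner) complex_inner
begin

definition scaleC_prod :: "complex \<Rightarrow> 'a \<times> 'b \<Rightarrow> 'a \<times> 'b"
  where "scaleC_prod c p = (c *\<^sub>C fst p, c *\<^sub>C snd p)"

definition cinner_prod :: "'a \<times> 'b \<Rightarrow> 'a \<times> 'b \<Rightarrow> complex"
  where "cinner_prod p q = cinner (fst p) (fst q) + cinner (snd p) (snd q)"

instance
proof
  fix x y :: "'a \<times> 'b"
  show "cinner x y = cnj (cinner y x)"
    unfolding cinner_prod_def complex_cnj_add
    by (metis cinner_commute)
  show "cinner x x = complex_of_real ((norm x)\<^sup>2)"
    by (simp add: cinner_prod_def cinner_self norm_prod_def)
qed (simp_all add: scaleC_prod_def cinner_prod_def scaleC_add_right scaleC_add_left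
      scaleC_scaleC scaleC_of_real cinner_add_left cinner_scaleC_left scaleR_prod_def
      algebra_simps)

end

instance prod :: (complex_hilbert_space, complex_hilbert_space) complex_hilbert_space ..

(* B(H): the bounded real-linear maps that are complex-linear, with the operator norm of the
   type of bounded linear functions. *)
definition bounded_ops :: "('a::complex_hilbert_space \<Rightarrow>\<^sub>L 'a) set"
  where "bounded_ops = {T. \<forall>c x. blinfun_apply T (c *\<^sub>C x) = c *\<^sub>C blinfun_apply T x}"

definition is_op_inverse ::
    "('a::complex_hilbert_space \<Rightarrow>\<^sub>L 'a) \<Rightarrow> ('a \<Rightarrow>\<^sub>L 'a) \<Rightarrow> bool"
  where "is_op_inverse T S \<longleftrightarrow>
    S \<in> bounded_ops \<and> T o\<^sub>L S = id_blinfun \<and> S o\<^sub>L T = id_blinfun"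

definition op_inv :: "('a::complex_hilbert_space \<Rightarrow>\<^sub>L 'a) \<Rightarrow> ('a \<Rightarrow>\<^sub>L 'a)"
  where "op_inv T = (THE S. is_op_inverse T S)"

definition op_nonneg :: "('a::complex_hilbert_space \<Rightarrow>\<^sub>L 'a) \<Rightarrow> bool"
  where "op_nonneg T \<longleftrightarrow> T \<in> bounded_ops \<and>
    (\<forall>x. cinner (blinfun_apply T x) x \<in> \<real> \<and> 0 \<le> Re (cinner (blinfun_apply T x) x))"

definition op_positive :: "('a::complex_hilbert_space \<Rightarrow>\<^sub>L 'a) \<Rightarrow> bool"
  where "op_positive T \<longleftrightarrow> T \<in> bounded_ops \<and>
    (\<forall>x. x \<noteq> 0 \<longrightarrow>
      cinner (blinfun_apply T x) x \<in> \<real> \<and> 0 < Re (cinner (blinfun_apply T x) x)) \<and>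
    (\<exists>S. is_op_inverse T S)"

definition op_le ::
    "('a::complex_hilbert_space \<Rightarrow>\<^sub>L 'a) \<Rightarrow> ('a \<Rightarrow>\<^sub>L 'a) \<Rightarrow> bool"
  where "op_le S T \<longleftrightarrow> op_nonneg (T - S)"

(* The unique nonnegative square root; meaningful for nonnegative arguments only. *)
definition op_sqrt :: "('a::complex_hilbert_space \<Rightarrow>\<^sub>L 'a) \<Rightarrow> ('a \<Rightarrow>\<^sub>L 'a)"
  where "op_sqrt T = (THE S. op_nonneg S \<and> S o\<^sub>L S = T)"

definition geo_mean ::
    "('a::complex_hilbert_space \<Rightarrow>\<^sub>L 'a) \<Rightarrow> ('a \<Rightarrow>\<^sub>L 'a) \<Rightarrow> ('a \<Rightarrow>\<^sub>L 'a)"  (infixl "\<sharp>" 70)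
  where "A \<sharp> B =
    op_sqrt A o\<^sub>L op_sqrt (op_inv (op_sqrt A) o\<^sub>L B o\<^sub>L op_inv (op_sqrt A)) o\<^sub>L op_sqrt A"

definition nat_mean ::
    "('a::complex_hilbert_space \<Rightarrow>\<^sub>L 'a) \<Rightarrow> ('a \<Rightarrow>\<^sub>L 'a) \<Rightarrow> ('a \<Rightarrow>\<^sub>L 'a)"  (infixl "\<natural>" 70)
  where "A \<natural> B =
    op_sqrt A o\<^sub>L op_sqrt (op_sqrt B o\<^sub>L op_inv A o\<^sub>L op_sqrt B) o\<^sub>L op_sqrt A"

definition kappa ::
    "('a::complex_hilbert_space \<Rightarrow>\<^sub>L 'a) \<Rightarrow> ('a \<Rightarrow>\<^sub>L 'a) \<Rightarrow> real"
  where "kappa S T = norm S * norm T"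

(* The operator matrix with rows (P, Q) and (R, S). *)
lift_definition op_matrix ::
    "('a::complex_hilbert_space \<Rightarrow>\<^sub>L 'a) \<Rightarrow> ('a \<Rightarrow>\<^sub>L 'a) \<Rightarrow> ('a \<Rightarrow>\<^sub>L 'a) \<Rightarrow> ('a \<Rightarrow>\<^sub>L 'a)
      \<Rightarrow> ('a \<times> 'a) \<Rightarrow>\<^sub>L ('a \<times> 'a)"
  is "\<lambda>P Q R S p. (P (fst p) + Q (snd p), R (fst p) + S (snd p))"
  by (intro bounded_linear_Pair bounded_linear_add;
      erule bounded_linear_compose; rule bounded_linear_fst bounded_linear_snd)

end

(* Both matrix entries have the form op_sqrt A o_L (...) o_L op_sqrt A, so it suffices to compare
   the inner square roots. From A \<le> B the operator A^(-1/2) B A^(-1/2) dominates the identity, and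
   so does its square root. On the other side B^(1/2) A^(-1) B^(1/2) is at most
   kappa(A^(-1), B), so its square root is at most sqrt(kappa(A^(-1), B)). Hence the off-diagonal
   entry lies between 0 and the diagonal entry, which makes the matrix nonnegative. *)
theory Submission
  imports Defs
begin

section \<open>Complex inner products\<close>

text \<open>Turns the operator space into a Banach space, so that dominated series of operators
  converge; the square root iteration relies on this.\<close>

instance complex_hilbert_space \<subseteq> banach ..

lemma cinner_add_right: "cinner x (y + z) = cinner x y + cinner (x::'a::complex_inner) z"
  by (metis cinner_add_left cinner_commute complex_cnj_add)

lemma cinner_scaleC_right: "cinner x (c *\<^sub>C y) = cnj c * cinner (x::'a::complex_inner) y"
  by (metis cinner_commute cinner_scaleC_left complex_cnj_mult)

lemma cinner_scaleR_left: "cinner (r *\<^sub>R x) y = of_real r * cinner (x::'a::complex_inner) y"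
  by (metis cinner_scaleC_left scaleC_of_real)

lemma cinner_scaleR_right: "cinner x (r *\<^sub>R y) = of_real r * cinner (x::'a::complex_inner) y"
  by (metis cinner_scaleC_right complex_cnj_complex_of_real scaleC_of_real)

lemma cinner_minus_left: "cinner (- x) y = - cinner (x::'a::complex_inner) y"
  using cinner_scaleR_left[of "-1" x y] by simp

lemma cinner_minus_right: "cinner x (- y) = - cinner (x::'a::complex_inner) y"
  using cinner_scaleR_right[of x "-1" y] by simp

lemma cinner_diff_left: "cinner (x - y) z = cinner x z - cinner (y::'a::complex_inner) z"
  using cinner_add_left[of x "- y" z] by (simp add: cinner_minus_left)

lemma cinner_diff_right: "cinner x (y - z) = cinner x y - cinner (x::'a::complex_inner) z"
  using cinner_add_right[of x y "- z"] by (simp add: cinner_minus_right)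

lemma cinner_zero_left [simp]: "cinner 0 (x::'a::complex_inner) = 0"
  using cinner_diff_left[of 0 0 x] by simp

lemma cinner_zero_right [simp]: "cinner (x::'a::complex_inner) 0 = 0"
  using cinner_diff_right[of x 0 0] by simp

lemma Re_cinner_commute: "Re (cinner x y) = Re (cinner y (x::'a::complex_inner))"
  by (subst cinner_commute) simp

lemma Re_cinner_self: "Re (cinner x x) = (norm (x::'a::complex_inner))\<^sup>2"
  by (simp add: cinner_self)

lemmas cinner_bilinear_simps =
  cinner_add_left cinner_add_right cinner_diff_left cinner_diff_right
  cinner_scaleR_left cinner_scaleR_right

lemma scaleC_diff_right: "c *\<^sub>C (x - y) = c *\<^sub>C x - c *\<^sub>C (y::'a::complex_inner)"
  by (metis add_diff_cancel diff_add_cancel scaleC_add_right)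

lemma scaleC_scaleR: "c *\<^sub>C (r *\<^sub>R x) = r *\<^sub>R (c *\<^sub>C (x::'a::complex_inner))"
  by (metis mult.commute scaleC_of_real scaleC_scaleC)

text \<open>For \<open>c > 0\<close> the minimum, attained at \<open>t = - b / c\<close>, equals
  \<open>a - b^2 / c\<close>; for \<open>c = 0\<close> an affine function bounded below must be
  constant. Both Cauchy-Schwarz inequalities below come from this.\<close>

lemma nonneg_quadratic_discriminant:
  fixes a b c :: real
  assumes nn: "\<And>t. 0 \<le> a + 2 * t * b + t\<^sup>2 * c" and "0 \<le> c"
  shows "b\<^sup>2 \<le> a * c"
proof (cases "c = 0")
  case True
  have "b = 0"
  proof (rule ccontr)
    assume "b \<noteq> 0"
    \<comment> \<open>At this \<open>t\<close> the affine function takes the value -1.\<close>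
    then show False using nn[of "- (a + 1) / (2 * b)"] True by (simp add: field_simps)
  qed
  then show ?thesis using True by simp
next
  case False
  then have "c > 0" using assms by simp
  have "0 \<le> a + 2 * (- b / c) * b + (- b / c)\<^sup>2 * c" by (rule nn)
  also have "\<dots> = a - b\<^sup>2 / c" using False by (simp add: field_simps power2_eq_square)
  finally show ?thesis using \<open>c > 0\<close> by (simp add: field_simps)
qed

text \<open>Discriminant of the squared norm of \<open>x + t y\<close>. Since \<open>t\<close> is
  real, only the real part is bounded here.\<close>

lemma Re_cinner_le_norm: "Re (cinner x y) \<le> norm x * norm (y::'a::complex_inner)"
proof -
  have "(Re (cinner x y))\<^sup>2 \<le> (norm x)\<^sup>2 * (norm y)\<^sup>2"
  proof (rule nonneg_quadratic_discriminant)
    fix t :: real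
    have "0 \<le> Re (cinner (x + t *\<^sub>R y) (x + t *\<^sub>R y))" by (simp add: Re_cinner_self)
    also have "\<dots> = (norm x)\<^sup>2 + 2 * t * Re (cinner x y) + t\<^sup>2 * (norm y)\<^sup>2"
      using Re_cinner_commute[of x y]
      by (simp add: cinner_bilinear_simps Re_cinner_self algebra_simps power2_eq_square)
    finally show "0 \<le> (norm x)\<^sup>2 + 2 * t * Re (cinner x y) + t\<^sup>2 * (norm y)\<^sup>2" .
  qed simp
  then have "(Re (cinner x y))\<^sup>2 \<le> (norm x * norm y)\<^sup>2" by (simp add: power_mult_distrib)
  then show ?thesis by (rule power2_le_imp_le) simp
qed

text \<open>Rotating \<open>x\<close> by the conjugate phase \<open>u\<close> of the inner product
  makes that product real and equal to its modulus, while the norm of \<open>x\<close> is unchanged;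
  the bound on real parts then applies.\<close>

lemma cmod_cinner_le_norm: "cmod (cinner x y) \<le> norm x * norm (y::'a::complex_inner)"
proof (cases "cinner x y = 0")
  case False
  define u where "u = cnj (sgn (cinner x y))"
  have nu: "cmod u = 1" using False by (simp add: u_def norm_sgn)
  have "cinner (u *\<^sub>C x) y = of_real (cmod (cinner x y))"
    using False complex_norm_square[of "cinner x y"]
    by (simp add: cinner_scaleC_left u_def sgn_eq field_simps power2_eq_square)
  then have "cmod (cinner x y) \<le> norm (u *\<^sub>C x) * norm y"
    by (metis Re_cinner_le_norm Re_complex_of_real)
  moreover have "(norm (u *\<^sub>C x))\<^sup>2 = (norm x)\<^sup>2"
  proof -
    have "cinner (u *\<^sub>C x) (u *\<^sub>C x) = of_real ((cmod u)\<^sup>2) * cinner x x"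
      unfolding cinner_scaleC_left cinner_scaleC_right complex_norm_square by simp
    then show ?thesis using nu by (simp add: cinner_self flip: of_real_power)
  qed
  ultimately show ?thesis by simp
qed simp

lemma bounded_bilinear_cinner:
  "bounded_bilinear (cinner :: 'a::complex_inner \<Rightarrow> 'a \<Rightarrow> complex)"
proof
  show "\<exists>K. \<forall>(a::'a) b. norm (cinner a b) \<le> norm a * norm b * K"
    by (rule exI[of _ 1]) (simp add: cmod_cinner_le_norm)
qed (simp_all add: cinner_bilinear_simps scaleR_conv_of_real)

text \<open>The class axioms tie the norm directly only to real scaling; complex homogeneity is read
  off from the inner product. It makes complex scaling continuous, so complex linearity survives
  limits.\<close>

lemma norm_scaleC: "norm (c *\<^sub>C x) = cmod c * norm (x::'a::complex_inner)"
proof -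
  have "cinner (c *\<^sub>C x) (c *\<^sub>C x) = of_real ((cmod c)\<^sup>2) * cinner x x"
    unfolding cinner_scaleC_left cinner_scaleC_right complex_norm_square by simp
  then have "of_real ((norm (c *\<^sub>C x))\<^sup>2) = complex_of_real ((cmod c * norm x)\<^sup>2)"
    by (simp add: cinner_self power_mult_distrib)
  then have "(norm (c *\<^sub>C x))\<^sup>2 = (cmod c * norm x)\<^sup>2" by (simp only: of_real_eq_iff)
  then show ?thesis by simp
qed

lemma bounded_linear_scaleC: "bounded_linear (\<lambda>x::'a::complex_inner. c *\<^sub>C x)"
  by (rule bounded_linear_intro[of _ "cmod c"])
    (simp_all add: scaleC_add_right scaleC_scaleR norm_scaleC)

section \<open>Self-adjoint and nonnegative operators\<close>

lemma bounded_opsD: "T \<in> bounded_ops \<Longrightarrow> blinfun_apply T (c *\<^sub>C x) = c *\<^sub>C blinfun_apply T x"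
  by (simp add: bounded_ops_def)

text \<open>Moving the operator across the inner product avoids constructing adjoints. Complex
  linearity is included so that the closure rules carry membership in \<open>bounded_ops\<close>
  along.\<close>

definition op_selfadj :: "('a::complex_hilbert_space \<Rightarrow>\<^sub>L 'a) \<Rightarrow> bool"
  where "op_selfadj T \<longleftrightarrow> T \<in> bounded_ops \<and>
    (\<forall>x y. cinner (blinfun_apply T x) y = cinner x (blinfun_apply T y))"

lemma op_selfadjD:
  "op_selfadj T \<Longrightarrow> cinner (blinfun_apply T x) y = cinner x (blinfun_apply T y)"
  by (simp add: op_selfadj_def)

lemma op_selfadj_id: "op_selfadj id_blinfun"
  by (simp add: op_selfadj_def bounded_ops_def)

lemma op_selfadj_add: "op_selfadj S \<Longrightarrow> op_selfadj T \<Longrightarrow> op_selfadj (S + T)"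
  by (simp add: op_selfadj_def bounded_ops_def blinfun.add_left scaleC_add_right
      cinner_bilinear_simps)

lemma op_selfadj_diff: "op_selfadj S \<Longrightarrow> op_selfadj T \<Longrightarrow> op_selfadj (S - T)"
  by (simp add: op_selfadj_def bounded_ops_def blinfun.diff_left scaleC_diff_right
      cinner_bilinear_simps)

lemma op_selfadj_scaleR: "op_selfadj T \<Longrightarrow> op_selfadj (r *\<^sub>R T)"
  by (simp add: op_selfadj_def bounded_ops_def blinfun.scaleR_left scaleC_scaleR
      cinner_bilinear_simps)

lemma op_selfadj_square: "op_selfadj T \<Longrightarrow> op_selfadj (T o\<^sub>L T)"
  by (simp add: op_selfadj_def bounded_ops_def)

lemma op_selfadj_conj: "op_selfadj S \<Longrightarrow> op_selfadj T \<Longrightarrow> op_selfadj (S o\<^sub>L T o\<^sub>L S)"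
  by (simp add: op_selfadj_def bounded_ops_def)

text \<open>Complex linearity and symmetry are pointwise equations between continuous expressions.
  Needed for the limit of the square root iteration.\<close>

lemma op_selfadj_limit:
  assumes lim: "Y \<longlonglongrightarrow> L" and sa: "\<And>n. op_selfadj (Y n)"
  shows "op_selfadj L"
proof -
  have app: "(\<lambda>n. blinfun_apply (Y n) x) \<longlonglongrightarrow> blinfun_apply L x" for x
    by (intro blinfun.tendsto lim tendsto_const)
  have "blinfun_apply L (c *\<^sub>C x) = c *\<^sub>C blinfun_apply L x" for c x
  proof (rule LIMSEQ_unique[OF app])
    have "(\<lambda>n. c *\<^sub>C blinfun_apply (Y n) x) \<longlonglongrightarrow> c *\<^sub>C blinfun_apply L x"
      by (rule bounded_linear.tendsto[OF bounded_linear_scaleC app])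
    then show "(\<lambda>n. blinfun_apply (Y n) (c *\<^sub>C x)) \<longlonglongrightarrow> c *\<^sub>C blinfun_apply L x"
      using sa by (simp add: op_selfadj_def bounded_ops_def)
  qed
  moreover have "cinner (blinfun_apply L x) y = cinner x (blinfun_apply L y)" for x y
  proof (rule LIMSEQ_unique)
    show "(\<lambda>n. cinner (blinfun_apply (Y n) x) y) \<longlonglongrightarrow> cinner (blinfun_apply L x) y"
      by (intro bounded_bilinear.tendsto[OF bounded_bilinear_cinner] app tendsto_const)
    have "(\<lambda>n. cinner x (blinfun_apply (Y n) y)) \<longlonglongrightarrow> cinner x (blinfun_apply L y)"
      by (intro bounded_bilinear.tendsto[OF bounded_bilinear_cinner] app tendsto_const)
    then show "(\<lambda>n. cinner (blinfun_apply (Y n) x) y) \<longlonglongrightarrow> cinner x (blinfun_apply L y)"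
      using sa by (simp add: op_selfadjD)
  qed
  ultimately show ?thesis by (simp add: op_selfadj_def bounded_ops_def)
qed

text \<open>Over the complex field real diagonal values force self-adjointness, by polarization.\<close>

lemma real_quadratic_form_imp_selfadj:
  assumes T: "T \<in> bounded_ops" and re: "\<And>x. cinner (blinfun_apply T x) x \<in> \<real>"
  shows "op_selfadj T"
proof -
  have im0: "Im (cinner (blinfun_apply T x) x) = 0" for x
    using re[of x] by (simp add: complex_is_Real_iff)
  have im: "Im (cinner (blinfun_apply T x) y) = - Im (cinner (blinfun_apply T y) x)" for x y
    using im0[of "x + y"] im0[of x] im0[of y] by (simp add: blinfun.add_right cinner_bilinear_simps)
  \<comment> \<open>Replacing \<open>x\<close> by \<open>i x\<close> in \<open>im\<close> turns
    imaginary parts into real parts.\<close>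
  have re': "Re (cinner (blinfun_apply T x) y) = Re (cinner (blinfun_apply T y) x)" for x y
    using im[of "\<i> *\<^sub>C x" y]
    by (simp add: bounded_opsD[OF T] cinner_scaleC_left cinner_scaleC_right)
  have "cinner (blinfun_apply T x) y = cinner x (blinfun_apply T y)" for x y
    using im[of x y] re'[of x y] cinner_commute[of x "blinfun_apply T y"] by (simp add: complex_eq_iff)
  then show ?thesis using T by (simp add: op_selfadj_def)
qed

text \<open>Working form of nonnegativity: polarization supplies symmetry, and conversely symmetry
  makes the diagonal values real.\<close>

lemma op_nonneg_iff_selfadj:
  "op_nonneg T \<longleftrightarrow> op_selfadj T \<and> (\<forall>x. 0 \<le> Re (cinner (blinfun_apply T x) x))"
proof
  assume "op_nonneg T"
  then show "op_selfadj T \<and> (\<forall>x. 0 \<le> Re (cinner (blinfun_apply T x) x))"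
    by (simp add: op_nonneg_def real_quadratic_form_imp_selfadj)
next
  assume T: "op_selfadj T \<and> (\<forall>x. 0 \<le> Re (cinner (blinfun_apply T x) x))"
  have "cinner (blinfun_apply T x) x \<in> \<real>" for x
    using T cinner_commute[of x "blinfun_apply T x"]
    by (simp add: op_selfadjD complex_is_Real_iff complex_eq_iff)
  then show "op_nonneg T" using T by (auto simp only: op_nonneg_def op_selfadj_def)
qed

lemma op_nonneg_selfadj: "op_nonneg T \<Longrightarrow> op_selfadj T"
  and op_nonneg_quadratic_form: "op_nonneg T \<Longrightarrow> 0 \<le> Re (cinner (blinfun_apply T x) x)"
  by (simp_all add: op_nonneg_iff_selfadj)

lemma op_nonneg_conj:
  assumes "op_selfadj S" and "op_nonneg T"
  shows "op_nonneg (S o\<^sub>L T o\<^sub>L S)"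
  using assms by (simp add: op_nonneg_iff_selfadj op_selfadj_conj) (metis op_selfadjD)

lemma op_nonneg_scaleR: "0 \<le> r \<Longrightarrow> op_nonneg T \<Longrightarrow> op_nonneg (r *\<^sub>R T)"
  by (simp add: op_nonneg_iff_selfadj op_selfadj_scaleR blinfun.scaleR_left cinner_scaleR_left)

text \<open>A nonnegative operator defines a possibly degenerate inner product; this is the
  discriminant of its form along \<open>x + t y\<close>.\<close>

lemma op_nonneg_cauchy_schwarz:
  assumes "op_nonneg T"
  shows "(Re (cinner (blinfun_apply T x) y))\<^sup>2
    \<le> Re (cinner (blinfun_apply T x) x) * Re (cinner (blinfun_apply T y) y)"
proof (rule nonneg_quadratic_discriminant)
  fix t :: real
  have sym: "Re (cinner (blinfun_apply T y) x) = Re (cinner (blinfun_apply T x) y)"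
    by (metis Re_cinner_commute assms op_nonneg_selfadj op_selfadjD)
  have "0 \<le> Re (cinner (blinfun_apply T (x + t *\<^sub>R y)) (x + t *\<^sub>R y))"
    by (rule op_nonneg_quadratic_form[OF assms])
  also have "\<dots> = Re (cinner (blinfun_apply T x) x) + 2 * t * Re (cinner (blinfun_apply T x) y)
      + t\<^sup>2 * Re (cinner (blinfun_apply T y) y)"
    by (simp add: blinfun.bilinear_simps cinner_bilinear_simps sym algebra_simps power2_eq_square)
  finally show "0 \<le> \<dots>" .
qed (rule op_nonneg_quadratic_form[OF assms])

text \<open>Cauchy-Schwarz with \<open>y = T x\<close> bounds the fourth power of the norm of
  \<open>T x\<close> by 0.\<close>

lemma op_nonneg_kernel:
  assumes "op_nonneg T" and "Re (cinner (blinfun_apply T x) x) = 0"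
  shows "blinfun_apply T x = 0"
  using op_nonneg_cauchy_schwarz[OF assms(1), of x "blinfun_apply T x"] assms(2)
  by (simp add: Re_cinner_self)

text \<open>In operator terms: 0 \<le> T \<le> 1 implies T^2 \<le> T. Cauchy-Schwarz with
  \<open>y = T x\<close> gives n^2 \<le> <Tx,x> n for n = |Tx|^2, and n cancels.\<close>

lemma norm_square_le_quadratic_form:
  assumes T: "op_nonneg T" and le: "\<And>x. Re (cinner (blinfun_apply T x) x) \<le> (norm x)\<^sup>2"
  shows "(norm (blinfun_apply T x))\<^sup>2 \<le> Re (cinner (blinfun_apply T x) x)"
proof (cases "blinfun_apply T x = 0")
  case False
  let ?n = "(norm (blinfun_apply T x))\<^sup>2"
  have "?n * ?n \<le> Re (cinner (blinfun_apply T x) x)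
      * Re (cinner (blinfun_apply T (blinfun_apply T x)) (blinfun_apply T x))"
    using op_nonneg_cauchy_schwarz[OF T, of x "blinfun_apply T x"]
    by (simp add: Re_cinner_self power2_eq_square)
  also have "\<dots> \<le> Re (cinner (blinfun_apply T x) x) * ?n"
    by (intro mult_left_mono le op_nonneg_quadratic_form[OF T])
  finally show ?thesis using False mult_right_le_imp_le[of ?n ?n] by simp
qed simp

lemma op_nonneg_norm_le_1:
  assumes T: "op_nonneg T" and le: "\<And>x. Re (cinner (blinfun_apply T x) x) \<le> (norm x)\<^sup>2"
  shows "norm T \<le> 1"
proof (rule norm_blinfun_bound)
  fix x
  have "(norm (blinfun_apply T x))\<^sup>2 \<le> (norm x)\<^sup>2"
    using norm_square_le_quadratic_form[OF assms] le order_trans by blast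
  then show "norm (blinfun_apply T x) \<le> 1 * norm x"
    using power2_le_imp_le[of "norm (blinfun_apply T x)" "norm x"] by simp
qed simp

lemma quadratic_form_le_norm:
  "Re (cinner (blinfun_apply T x) x) \<le> norm T * (norm (x::'a::complex_hilbert_space))\<^sup>2"
proof -
  have "Re (cinner (blinfun_apply T x) x) \<le> norm (blinfun_apply T x) * norm x"
    by (rule Re_cinner_le_norm)
  also have "\<dots> \<le> norm T * norm x * norm x"
    by (intro mult_right_mono norm_blinfun) simp
  finally show ?thesis by (simp add: power2_eq_square mult.assoc)
qed

section \<open>Square roots\<close>

lemma compose_eqD: "S o\<^sub>L T = U \<Longrightarrow> blinfun_apply S (blinfun_apply T x) = blinfun_apply U x"
  by (metis blinfun_apply_blinfun_compose comp_apply)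

lemma blinfun_compose_assoc: "(S o\<^sub>L T) o\<^sub>L U = S o\<^sub>L (T o\<^sub>L U)"
  by (rule blinfun_eqI) simp

text \<open>With \<open>E = 1 - T\<close>, the limit \<open>Y\<close> of this iteration satisfies \<open>2 Y = E + Y\<^sup>2\<close>, that is
  \<open>(1 - Y)\<^sup>2 = T\<close>.\<close>

primrec sqrt_iter :: "('a::complex_hilbert_space \<Rightarrow>\<^sub>L 'a) \<Rightarrow> nat \<Rightarrow> ('a \<Rightarrow>\<^sub>L 'a)"
  where "sqrt_iter E 0 = 0"
  | "sqrt_iter E (Suc n) = (1/2) *\<^sub>R (E + (sqrt_iter E n o\<^sub>L sqrt_iter E n))"

text \<open>The same iteration for the scalar \<open>E = 1\<close>. It majorizes the norms of the
  operator iterates and also the norms of their increments.\<close>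

primrec sqrt_iter_bound :: "nat \<Rightarrow> real"
  where "sqrt_iter_bound 0 = 0"
  | "sqrt_iter_bound (Suc n) = (1 + (sqrt_iter_bound n)\<^sup>2) / 2"

lemma sqrt_iter_bound_le_1: "0 \<le> sqrt_iter_bound n \<and> sqrt_iter_bound n \<le> 1"
  by (induction n) (auto simp: power_le_one)

lemma sqrt_iter_bound_mono: "incseq sqrt_iter_bound"
proof (rule incseq_SucI)
  fix n
  have "0 \<le> (1 - sqrt_iter_bound n)\<^sup>2" by simp
  then show "sqrt_iter_bound n \<le> sqrt_iter_bound (Suc n)"
    by (simp add: power2_eq_square algebra_simps)
qed

text \<open>Each iterate is a polynomial in \<open>E\<close>. This lets differences of squares
  factor, and in the limit shows that the root commutes with whatever commutes with
  \<open>T\<close>.\<close>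

lemma sqrt_iter_commute:
  assumes "S o\<^sub>L E = E o\<^sub>L S"
  shows "S o\<^sub>L sqrt_iter E n = sqrt_iter E n o\<^sub>L S"
proof (induction n)
  case (Suc n)
  show ?case
    using compose_eqD[OF Suc] compose_eqD[OF assms]
    by (intro blinfun_eqI) (simp add: blinfun.bilinear_simps)
qed (auto intro!: blinfun_eqI simp: blinfun.bilinear_simps)

lemma norm_sqrt_iter:
  assumes "norm E \<le> 1"
  shows "norm (sqrt_iter E n) \<le> sqrt_iter_bound n"
proof (induction n)
  case (Suc n)
  have "norm (E + (sqrt_iter E n o\<^sub>L sqrt_iter E n)) \<le> norm E + norm (sqrt_iter E n) * norm (sqrt_iter E n)"
    by (intro order_trans[OF norm_triangle_ineq] add_left_mono norm_blinfun_compose)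
  also have "\<dots> \<le> 1 + sqrt_iter_bound n * sqrt_iter_bound n"
    using sqrt_iter_bound_le_1 by (intro add_mono mult_mono assms Suc) auto
  finally show ?case by (simp add: power2_eq_square)
qed simp

text \<open>Commuting iterates satisfy Y^2 - Z^2 = (Y + Z)(Y - Z); the scalar sequence factors in
  the same way, so the bound propagates by induction.\<close>

lemma norm_sqrt_iter_step:
  assumes E: "norm E \<le> 1"
  shows "norm (sqrt_iter E (Suc n) - sqrt_iter E n) \<le> sqrt_iter_bound (Suc n) - sqrt_iter_bound n"
proof (induction n)
  case 0
  then show ?case using E by simp
next
  case (Suc n)
  let ?Y = "sqrt_iter E (Suc n)" and ?Z = "sqrt_iter E n"
  let ?y = "sqrt_iter_bound (Suc n)" and ?z = "sqrt_iter_bound n"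
  \<comment> \<open>First \<open>E\<close> commutes with an iterate, hence that iterate commutes
    with every other one.\<close>
  have comm: "?Y o\<^sub>L ?Z = ?Z o\<^sub>L ?Y"
    using sqrt_iter_commute[OF sqrt_iter_commute[OF refl, symmetric]] .
  have "sqrt_iter E (Suc (Suc n)) - ?Y = (1/2) *\<^sub>R ((?Y o\<^sub>L ?Y) - (?Z o\<^sub>L ?Z))"
    by (simp only: sqrt_iter.simps) (simp add: algebra_simps)
  also have "(?Y o\<^sub>L ?Y) - (?Z o\<^sub>L ?Z) = (?Y + ?Z) o\<^sub>L (?Y - ?Z)"
    using compose_eqD[OF comm]
    by (intro blinfun_eqI) (simp add: blinfun.bilinear_simps del: sqrt_iter.simps)
  finally have "norm (sqrt_iter E (Suc (Suc n)) - ?Y) = norm ((?Y + ?Z) o\<^sub>L (?Y - ?Z)) / 2"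
    by simp
  also have "norm ((?Y + ?Z) o\<^sub>L (?Y - ?Z)) \<le> norm (?Y + ?Z) * norm (?Y - ?Z)"
    by (rule norm_blinfun_compose)
  also have "\<dots> \<le> (?y + ?z) * (?y - ?z)"
  proof (rule mult_mono[OF _ Suc])
    show "norm (?Y + ?Z) \<le> ?y + ?z"
      by (rule norm_triangle_mono[OF norm_sqrt_iter[OF E] norm_sqrt_iter[OF E]])
    show "0 \<le> ?y + ?z" using sqrt_iter_bound_le_1 by (intro add_nonneg_nonneg) blast+
  qed simp
  finally have "norm (sqrt_iter E (Suc (Suc n)) - ?Y) \<le> (?y + ?z) * (?y - ?z) / 2" by simp
  also have "(?y + ?z) * (?y - ?z) / 2 = sqrt_iter_bound (Suc (Suc n)) - ?y"
    by (simp only: sqrt_iter_bound.simps) (simp add: field_simps power2_eq_square)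
  finally show ?case .
qed

text \<open>The increments are dominated by those of a bounded increasing real sequence, which
  telescope to a convergent series. This covers the boundary case \<open>norm E = 1\<close>.\<close>

lemma sqrt_iter_convergent:
  assumes E: "norm E \<le> 1"
  shows "convergent (sqrt_iter E)"
proof -
  obtain l where "sqrt_iter_bound \<longlonglongrightarrow> l"
    using incseq_convergent[OF sqrt_iter_bound_mono, of 1] sqrt_iter_bound_le_1 by blast
  then have "summable (\<lambda>n. sqrt_iter_bound (Suc n) - sqrt_iter_bound n)"
    by (rule telescope_summable)
  then have "summable (\<lambda>n. sqrt_iter E (Suc n) - sqrt_iter E n)"
    by (rule summable_comparison_test') (rule norm_sqrt_iter_step[OF E])
  then have "convergent (\<lambda>n. \<Sum>k<n. sqrt_iter E (Suc k) - sqrt_iter E k)"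
    by (simp add: summable_iff_convergent)
  then show ?thesis by (simp only: sum_lessThan_telescope) simp
qed

text \<open>The root is \<open>1 - Y\<close> for the limit \<open>Y\<close> of the iteration. The
  commutation clause is inherited from the iterates and is what the uniqueness proof needs.\<close>

lemma exists_sqrt_contraction:
  assumes T: "op_nonneg T" and le: "norm T \<le> 1"
  shows "\<exists>S. op_nonneg S \<and> S o\<^sub>L S = T \<and> (\<forall>U. U o\<^sub>L T = T o\<^sub>L U \<longrightarrow> U o\<^sub>L S = S o\<^sub>L U)"
proof -
  define E where "E = id_blinfun - T"
  have saE: "op_selfadj E"
    by (simp add: E_def op_selfadj_diff op_selfadj_id op_nonneg_selfadj T)
  \<comment> \<open>T \<le> 1 gives E \<ge> 0 here, and T \<ge> 0 gives E \<le> 1 below; together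
    they yield norm E \<le> 1.\<close>
  have "0 \<le> Re (cinner (blinfun_apply E x) x)" for x
  proof -
    have "norm T * (norm x)\<^sup>2 \<le> (norm x)\<^sup>2" using le by (simp add: mult_left_le_one_le)
    then show ?thesis
      using quadratic_form_le_norm[of T x]
      by (simp add: E_def blinfun.diff_left cinner_diff_left Re_cinner_self)
  qed
  then have "op_nonneg E" using saE by (simp add: op_nonneg_iff_selfadj)
  then have E1: "norm E \<le> 1"
    by (rule op_nonneg_norm_le_1)
      (simp add: E_def blinfun.diff_left cinner_diff_left Re_cinner_self op_nonneg_quadratic_form T)
  obtain Y where Y: "sqrt_iter E \<longlonglongrightarrow> Y"
    using sqrt_iter_convergent[OF E1] by (auto simp: convergent_def)
  have saY: "op_selfadj Y"
  proof (rule op_selfadj_limit[OF Y])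
    fix n show "op_selfadj (sqrt_iter E n)"
    proof (induction n)
      case 0
      then show ?case using op_selfadj_scaleR[OF op_selfadj_id, of 0] by simp
    next
      case (Suc n)
      then show ?case by (simp add: op_selfadj_scaleR op_selfadj_add op_selfadj_square saE)
    qed
  qed
  \<comment> \<open>This bound is what makes \<open>1 - Y\<close> nonnegative.\<close>
  have nY: "norm Y \<le> 1"
  proof (rule LIMSEQ_le_const2[OF tendsto_norm[OF Y]], intro exI allI impI)
    fix n show "norm (sqrt_iter E n) \<le> 1"
      using norm_sqrt_iter[OF E1, of n] sqrt_iter_bound_le_1[of n] by linarith
  qed
  have comp_lim: "(\<lambda>n. F n o\<^sub>L G n) \<longlonglongrightarrow> (F0 o\<^sub>L G0)" if "F \<longlonglongrightarrow> F0" "G \<longlonglongrightarrow> G0"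
    for F G :: "nat \<Rightarrow> ('a \<Rightarrow>\<^sub>L 'a)" and F0 G0
    by (rule bounded_bilinear.tendsto[OF bounded_bilinear_blinfun_compose that])
  have fixpoint: "Y = (1/2) *\<^sub>R (E + (Y o\<^sub>L Y))"
  proof (rule LIMSEQ_unique)
    show "(\<lambda>n. sqrt_iter E (Suc n)) \<longlonglongrightarrow> Y" by (rule LIMSEQ_Suc[OF Y])
    show "(\<lambda>n. sqrt_iter E (Suc n)) \<longlonglongrightarrow> (1/2) *\<^sub>R (E + (Y o\<^sub>L Y))"
      by (simp only: sqrt_iter.simps) (intro tendsto_intros comp_lim Y)
  qed
  define S where "S = id_blinfun - Y"
  have "op_nonneg S"
    unfolding op_nonneg_iff_selfadj
  proof (intro conjI allI)
    show "op_selfadj S" by (simp add: S_def op_selfadj_diff op_selfadj_id saY)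
    fix x :: 'a
    have "norm Y * (norm x)\<^sup>2 \<le> (norm x)\<^sup>2" using nY by (simp add: mult_left_le_one_le)
    then show "0 \<le> Re (cinner (blinfun_apply S x) x)"
      using quadratic_form_le_norm[of Y x]
      by (simp add: S_def blinfun.diff_left cinner_diff_left Re_cinner_self)
  qed
  moreover have "S o\<^sub>L S = T"
  proof (rule blinfun_eqI)
    fix x
    have "2 *\<^sub>R Y = E + (Y o\<^sub>L Y)"
      using arg_cong[OF fixpoint, of "\<lambda>Z. 2 *\<^sub>R Z"] by simp
    then have "2 *\<^sub>R blinfun_apply Y x = blinfun_apply E x + blinfun_apply Y (blinfun_apply Y x)"
      by (metis blinfun.add_left blinfun.scaleR_left blinfun_apply_blinfun_compose comp_apply)
    then show "blinfun_apply (S o\<^sub>L S) x = blinfun_apply T x"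
      by (simp add: S_def E_def blinfun.bilinear_simps algebra_simps scaleR_2)
  qed
  moreover have "U o\<^sub>L S = S o\<^sub>L U" if "U o\<^sub>L T = T o\<^sub>L U" for U
  proof -
    have "U o\<^sub>L E = E o\<^sub>L U"
      using compose_eqD[OF that] by (intro blinfun_eqI) (simp add: E_def blinfun.bilinear_simps)
    then have "(\<lambda>n. U o\<^sub>L sqrt_iter E n) = (\<lambda>n. sqrt_iter E n o\<^sub>L U)"
      by (simp add: sqrt_iter_commute)
    then have "(\<lambda>n. sqrt_iter E n o\<^sub>L U) \<longlonglongrightarrow> (U o\<^sub>L Y)"
      using comp_lim[OF tendsto_const Y, of U] by (simp only:)
    then have "U o\<^sub>L Y = Y o\<^sub>L U"
      by (rule LIMSEQ_unique[OF _ comp_lim[OF Y tendsto_const]])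
    from compose_eqD[OF this] show ?thesis
      by (intro blinfun_eqI) (simp add: S_def blinfun.bilinear_simps)
  qed
  ultimately show ?thesis by blast
qed

lemma exists_sqrt:
  assumes T: "op_nonneg T"
  shows "\<exists>S. op_nonneg S \<and> S o\<^sub>L S = T \<and> (\<forall>U. U o\<^sub>L T = T o\<^sub>L U \<longrightarrow> U o\<^sub>L S = S o\<^sub>L U)"
proof -
  \<comment> \<open>Rescaling by \<open>k\<close> moves \<open>T\<close> into the unit ball; the
    summand 1 keeps \<open>k\<close> positive even for \<open>T = 0\<close>.\<close>
  define k where "k = norm T + 1"
  have k: "k > 0" by (simp add: k_def add_nonneg_pos)
  have "norm ((1 / k) *\<^sub>R T) \<le> 1" using k by (simp add: k_def)
  moreover have "op_nonneg ((1 / k) *\<^sub>R T)" using op_nonneg_scaleR[OF _ T] k by simp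
  ultimately obtain S where S: "op_nonneg S" "S o\<^sub>L S = (1 / k) *\<^sub>R T"
    and comm: "\<And>U. U o\<^sub>L ((1 / k) *\<^sub>R T) = ((1 / k) *\<^sub>R T) o\<^sub>L U \<Longrightarrow> U o\<^sub>L S = S o\<^sub>L U"
    using exists_sqrt_contraction by blast
  have square: "(sqrt k *\<^sub>R S) o\<^sub>L (sqrt k *\<^sub>R S) = T"
    using compose_eqD[OF S(2)] k by (intro blinfun_eqI) (simp add: blinfun.bilinear_simps)
  have commute: "U o\<^sub>L (sqrt k *\<^sub>R S) = (sqrt k *\<^sub>R S) o\<^sub>L U" if U: "U o\<^sub>L T = T o\<^sub>L U" for U
  proof -
    have "U o\<^sub>L ((1 / k) *\<^sub>R T) = ((1 / k) *\<^sub>R T) o\<^sub>L U"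
      using compose_eqD[OF U] by (intro blinfun_eqI) (simp add: blinfun.bilinear_simps)
    from compose_eqD[OF comm[OF this]] show ?thesis
      by (intro blinfun_eqI) (simp add: blinfun.bilinear_simps)
  qed
  have "op_nonneg (sqrt k *\<^sub>R S)" using S k by (simp add: op_nonneg_scaleR)
  with square show ?thesis by (intro exI[of _ "sqrt k *\<^sub>R S"] conjI allI impI commute)
qed

text \<open>By commutation (R + S)(R - S) = 0. On y = (R - S)x the two nonnegative forms sum to 0,
  so both vanish and Ry = Sy = 0; then <y,y> = <x,(R - S)y> = 0.\<close>

lemma commuting_sqrt_unique:
  assumes R: "op_nonneg R" and S: "op_nonneg S"
    and eq: "R o\<^sub>L R = S o\<^sub>L S" and comm: "R o\<^sub>L S = S o\<^sub>L R"
  shows "R = S"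
proof (rule blinfun_eqI)
  fix x
  define y where "y = blinfun_apply R x - blinfun_apply S x"
  have "blinfun_apply R y + blinfun_apply S y = 0"
    using compose_eqD[OF eq] compose_eqD[OF comm] by (simp add: y_def blinfun.bilinear_simps)
  then have "Re (cinner (blinfun_apply R y) y) + Re (cinner (blinfun_apply S y) y) = 0"
    by (metis cinner_add_left cinner_zero_left plus_complex.sel(1) zero_complex.sel(1))
  then have "Re (cinner (blinfun_apply R y) y) = 0" "Re (cinner (blinfun_apply S y) y) = 0"
    using op_nonneg_quadratic_form[OF R, of y] op_nonneg_quadratic_form[OF S, of y] by linarith+
  then have y0: "blinfun_apply R y = 0" "blinfun_apply S y = 0"
    using op_nonneg_kernel R S by blast+
  have "cinner y y = cinner x (blinfun_apply R y) - cinner x (blinfun_apply S y)"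
    using R S by (subst (1) y_def)
      (simp add: cinner_diff_left op_nonneg_selfadj op_selfadjD)
  then have "y = 0" by (simp add: y0 cinner_self)
  then show "blinfun_apply R x = blinfun_apply S x" by (simp add: y_def)
qed

lemma
  assumes T: "op_nonneg T"
  shows op_sqrt_nonneg: "op_nonneg (op_sqrt T)" and op_sqrt_square: "op_sqrt T o\<^sub>L op_sqrt T = T"
proof -
  obtain S where S: "op_nonneg S" "S o\<^sub>L S = T"
    and comm: "\<And>U. U o\<^sub>L T = T o\<^sub>L U \<Longrightarrow> U o\<^sub>L S = S o\<^sub>L U"
    using exists_sqrt[OF T] by blast
  have "R = S" if R: "op_nonneg R" "R o\<^sub>L R = T" for R
  proof (rule commuting_sqrt_unique[OF R(1) S(1)])
    show "R o\<^sub>L R = S o\<^sub>L S" by (simp add: R S)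
    \<comment> \<open>Any root \<open>R\<close> commutes with T = R^2, hence with the constructed
      root \<open>S\<close>.\<close>
    show "R o\<^sub>L S = S o\<^sub>L R"
      by (rule comm) (simp add: blinfun_compose_assoc flip: R(2))
  qed
  then have "op_sqrt T = S"
    unfolding op_sqrt_def using S by (intro the_equality) blast+
  then show "op_nonneg (op_sqrt T)" "op_sqrt T o\<^sub>L op_sqrt T = T" using S by simp_all
qed

text \<open>One factor of the root moves across the inner product. This translates between bounds on
  the form of \<open>T\<close> and norm bounds on its root.\<close>

lemma norm_op_sqrt_square:
  assumes "op_nonneg T"
  shows "(norm (blinfun_apply (op_sqrt T) x))\<^sup>2 = Re (cinner (blinfun_apply T x) x)"
  using op_selfadjD[OF op_nonneg_selfadj[OF op_sqrt_nonneg[OF assms]],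
      of "blinfun_apply (op_sqrt T) x" x] compose_eqD[OF op_sqrt_square[OF assms], of x]
  by (simp flip: Re_cinner_self)

section \<open>Inverses\<close>

lemma is_op_inverseD:
  assumes "is_op_inverse T S"
  shows "S \<in> bounded_ops" "blinfun_apply T (blinfun_apply S x) = x"
    "blinfun_apply S (blinfun_apply T x) = x"
  using assms compose_eqD[of T S id_blinfun] compose_eqD[of S T id_blinfun]
  by (simp_all add: is_op_inverse_def)

lemma op_inv_eqI:
  assumes "is_op_inverse T S"
  shows "op_inv T = S"
  unfolding op_inv_def
proof (rule the_equality)
  show "is_op_inverse T S" by (rule assms)
  fix R assume R: "is_op_inverse T R"
  show "R = S"
    using is_op_inverseD(3)[OF R] is_op_inverseD(2)[OF assms]
    by (intro blinfun_eqI) metis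
qed

lemma op_inv_is_inverse: "is_op_inverse T S \<Longrightarrow> is_op_inverse T (op_inv T)"
  using op_inv_eqI by metis

lemma selfadj_inverse:
  assumes T: "op_selfadj T" and inv: "is_op_inverse T S"
  shows "op_selfadj S"
  unfolding op_selfadj_def
proof (intro conjI allI)
  show "S \<in> bounded_ops" by (rule is_op_inverseD[OF inv])
  fix x y
  show "cinner (blinfun_apply S x) y = cinner x (blinfun_apply S y)"
    using op_selfadjD[OF T, of "blinfun_apply S x" "blinfun_apply S y"]
    by (simp add: is_op_inverseD[OF inv])
qed

lemma nonneg_inverse:
  assumes T: "op_nonneg T" and inv: "is_op_inverse T S"
  shows "op_nonneg S"
  unfolding op_nonneg_iff_selfadj
proof (intro conjI allI)
  show S: "op_selfadj S" using selfadj_inverse[OF op_nonneg_selfadj[OF T] inv] .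
  fix x
  show "0 \<le> Re (cinner (blinfun_apply S x) x)"
    using op_nonneg_quadratic_form[OF T, of "blinfun_apply S x"]
    by (simp add: is_op_inverseD[OF inv] Re_cinner_commute[of x])
qed

text \<open>The inverse of the root is the root composed with \<open>V\<close>, the inverse of
  \<open>T\<close>.\<close>

lemma op_sqrt_invertible:
  assumes T: "op_nonneg T" and inv: "is_op_inverse T V"
  shows "is_op_inverse (op_sqrt T) (op_inv (op_sqrt T))"
proof -
  let ?S = "op_sqrt T"
  have ST: "blinfun_apply ?S (blinfun_apply ?S x) = blinfun_apply T x" for x
    by (rule compose_eqD[OF op_sqrt_square[OF T]])
  have right: "blinfun_apply ?S (blinfun_apply ?S (blinfun_apply V x)) = x" for x
    by (simp add: ST is_op_inverseD[OF inv])
  have left: "blinfun_apply V (blinfun_apply ?S (blinfun_apply ?S x)) = x" for x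
    by (simp add: ST is_op_inverseD[OF inv])
  \<comment> \<open>Write the \<open>x\<close> on the left as S S V x by \<open>right\<close>, then
    cancel V S S by \<open>left\<close>.\<close>
  have comm: "blinfun_apply V (blinfun_apply ?S x) = blinfun_apply ?S (blinfun_apply V x)" for x
    by (metis left right)
  have "is_op_inverse ?S (?S o\<^sub>L V)"
    unfolding is_op_inverse_def
  proof (intro conjI blinfun_eqI)
    show "?S o\<^sub>L V \<in> bounded_ops"
      using op_nonneg_selfadj[OF op_sqrt_nonneg[OF T]] is_op_inverseD(1)[OF inv]
      by (simp add: op_selfadj_def bounded_ops_def)
  qed (use right comm left in simp_all)
  then show ?thesis by (rule op_inv_is_inverse)
qed

lemma op_positive_nonneg: "op_positive T \<Longrightarrow> op_nonneg T"
  unfolding op_positive_def op_nonneg_def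
  by (metis Reals_0 cinner_zero_right less_imp_le order_refl zero_complex.sel(1))

section \<open>Comparison of the two means\<close>

text \<open>T \<ge> 1 makes the inverse root \<open>S\<close> a contraction: |Sy|^2 \<le> <TSy,Sy> =
  |y|^2. Hence 0 \<le> S \<le> 1 and S^2 \<le> S, which at y = T^(1/2) x is the claim.\<close>

lemma quadratic_form_op_sqrt_ge:
  assumes T: "op_nonneg T" and inv: "is_op_inverse T V"
    and ge: "\<And>x. (norm x)\<^sup>2 \<le> Re (cinner (blinfun_apply T x) x)"
  shows "(norm x)\<^sup>2 \<le> Re (cinner (blinfun_apply (op_sqrt T) x) x)"
proof -
  define S where "S = op_inv (op_sqrt T)"
  have S: "is_op_inverse (op_sqrt T) S"
    unfolding S_def by (rule op_sqrt_invertible[OF T inv])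
  have nS: "op_nonneg S" by (rule nonneg_inverse[OF op_sqrt_nonneg[OF T] S])
  have contr: "norm (blinfun_apply S y) \<le> norm y" for y
  proof (rule power2_le_imp_le)
    show "(norm (blinfun_apply S y))\<^sup>2 \<le> (norm y)\<^sup>2"
      using ge[of "blinfun_apply S y"] norm_op_sqrt_square[OF T, of "blinfun_apply S y"]
      by (simp add: is_op_inverseD[OF S])
  qed simp
  have "Re (cinner (blinfun_apply S y) y) \<le> (norm y)\<^sup>2" for y
  proof -
    have "Re (cinner (blinfun_apply S y) y) \<le> norm (blinfun_apply S y) * norm y"
      by (rule Re_cinner_le_norm)
    also have "\<dots> \<le> norm y * norm y" by (intro mult_right_mono contr) simp
    finally show ?thesis by (simp add: power2_eq_square)
  qed
  then have "(norm (blinfun_apply S y))\<^sup>2 \<le> Re (cinner (blinfun_apply S y) y)" for y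
    by (rule norm_square_le_quadratic_form[OF nS])
  from this[of "blinfun_apply (op_sqrt T) x"] show ?thesis
    by (simp add: is_op_inverseD[OF S] Re_cinner_commute[of x])
qed

text \<open>The form bound says that the root has norm at most \<open>sqrt c\<close>; Cauchy-Schwarz
  turns this back into a form bound.\<close>

lemma quadratic_form_op_sqrt_le:
  assumes T: "op_nonneg T" and le: "\<And>x. Re (cinner (blinfun_apply T x) x) \<le> c * (norm x)\<^sup>2"
    and c: "0 \<le> c"
  shows "Re (cinner (blinfun_apply (op_sqrt T) x) x) \<le> sqrt c * (norm x)\<^sup>2"
proof -
  have "norm (blinfun_apply (op_sqrt T) x) \<le> sqrt c * norm x"
    using le[of x] c
    by - (rule power2_le_imp_le, simp_all add: norm_op_sqrt_square[OF T] power_mult_distrib)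
  then have "norm (blinfun_apply (op_sqrt T) x) * norm x \<le> sqrt c * norm x * norm x"
    by (intro mult_right_mono) simp_all
  then show ?thesis
    using Re_cinner_le_norm[of "blinfun_apply (op_sqrt T) x" x]
    by (simp add: power2_eq_square mult.assoc)
qed

text \<open>Replacing \<open>G\<close> by the smaller \<open>P\<close> on the diagonal leaves
  exactly the form of \<open>P\<close> at \<open>x + y\<close>.\<close>

lemma op_matrix_nonneg:
  assumes G: "op_selfadj G" and P: "op_nonneg P"
    and le: "\<And>x. Re (cinner (blinfun_apply P x) x) \<le> Re (cinner (blinfun_apply G x) x)"
  shows "op_nonneg (op_matrix G P P G)"
  unfolding op_nonneg_iff_selfadj
proof (intro conjI allI)
  note sa = G op_nonneg_selfadj[OF P]
  show "op_selfadj (op_matrix G P P G)"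
    using sa by (auto simp: op_selfadj_def bounded_ops_def op_matrix.rep_eq scaleC_prod_def
        cinner_prod_def scaleC_add_right cinner_bilinear_simps)
  fix p :: "'a \<times> 'a"
  obtain x y where p: "p = (x, y)" by (cases p)
  have "0 \<le> Re (cinner (blinfun_apply P (x + y)) (x + y))"
    by (rule op_nonneg_quadratic_form[OF P])
  then show "0 \<le> Re (cinner (blinfun_apply (op_matrix G P P G) p) p)"
    using le[of x] le[of y]
    by (simp add: p op_matrix.rep_eq cinner_prod_def cinner_bilinear_simps blinfun.add_right)
qed

theorem theorem2p2:
  fixes A B :: "'a::complex_hilbert_space \<Rightarrow>\<^sub>L 'a"
  assumes "op_positive A" and "op_positive B" and "op_le A B"
  shows "op_nonneg (op_matrix
           (sqrt (kappa (op_inv A) B) *\<^sub>R (A \<sharp> B)) (A \<natural> B)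
           (A \<natural> B) (sqrt (kappa (op_inv A) B) *\<^sub>R (A \<sharp> B)))"
proof -
  define c where "c = kappa (op_inv A) B"
  define R where "R = op_sqrt A"
  define V where "V = op_inv R"
  define X where "X = V o\<^sub>L B o\<^sub>L V"
  define Y where "Y = op_sqrt B o\<^sub>L op_inv A o\<^sub>L op_sqrt B"
  have A: "op_nonneg A" and B: "op_nonneg B" using assms op_positive_nonneg by auto
  have Ai: "is_op_inverse A (op_inv A)" and Bi: "is_op_inverse B (op_inv B)"
    using assms op_inv_is_inverse by (auto simp: op_positive_def)
  have R: "op_nonneg R" and RR: "R o\<^sub>L R = A"
    unfolding R_def by (rule op_sqrt_nonneg[OF A], rule op_sqrt_square[OF A])
  have V: "is_op_inverse R V"
    unfolding V_def R_def by (rule op_sqrt_invertible[OF A Ai])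
  have saR: "op_selfadj R" and saV: "op_selfadj V"
    using op_nonneg_selfadj[OF R] selfadj_inverse[OF _ V] by auto
  have X: "op_nonneg X" unfolding X_def by (rule op_nonneg_conj[OF saV B])
  \<comment> \<open>Invertibility of \<open>X\<close> is required for the lower bound on its
    root.\<close>
  have Xi: "is_op_inverse X (R o\<^sub>L op_inv B o\<^sub>L R)"
    unfolding is_op_inverse_def
  proof (intro conjI blinfun_eqI)
    show "R o\<^sub>L op_inv B o\<^sub>L R \<in> bounded_ops"
      using op_selfadj_conj[OF saR selfadj_inverse[OF op_nonneg_selfadj[OF B] Bi]]
      by (simp add: op_selfadj_def)
  qed (simp_all add: X_def is_op_inverseD[OF V] is_op_inverseD[OF Bi])
  \<comment> \<open>With u = A^(-1/2) x the claim becomes <Au,u> \<le> <Bu,u>, which is the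
    hypothesis A \<le> B.\<close>
  have "(norm x)\<^sup>2 \<le> Re (cinner (blinfun_apply X x) x)" for x
  proof -
    let ?u = "blinfun_apply V x"
    have "(norm x)\<^sup>2 = Re (cinner (blinfun_apply A ?u) ?u)"
      using norm_op_sqrt_square[OF A, of ?u] by (simp add: is_op_inverseD[OF V] flip: R_def)
    also have "\<dots> \<le> Re (cinner (blinfun_apply B ?u) ?u)"
      using assms(3) op_nonneg_quadratic_form[of "B - A" ?u]
      by (simp add: op_le_def blinfun.diff_left cinner_diff_left)
    also have "\<dots> = Re (cinner (blinfun_apply X x) x)"
      by (simp add: X_def op_selfadjD[OF saV])
    finally show ?thesis .
  qed
  then have X_ge: "(norm x)\<^sup>2 \<le> Re (cinner (blinfun_apply (op_sqrt X) x) x)" for x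
    by (rule quadratic_form_op_sqrt_ge[OF X Xi])
  have saB: "op_selfadj (op_sqrt B)" by (rule op_nonneg_selfadj[OF op_sqrt_nonneg[OF B]])
  have Y: "op_nonneg Y"
    unfolding Y_def by (rule op_nonneg_conj[OF saB nonneg_inverse[OF A Ai]])
  \<comment> \<open>The two factors of \<open>c\<close> arise separately:
    \<open>norm (op_inv A)\<close> from the middle operator, \<open>norm B\<close> from |B^(1/2)
    x|^2 = <Bx,x>.\<close>
  have "Re (cinner (blinfun_apply Y x) x) \<le> c * (norm x)\<^sup>2" for x
  proof -
    let ?u = "blinfun_apply (op_sqrt B) x"
    have "Re (cinner (blinfun_apply Y x) x) = Re (cinner (blinfun_apply (op_inv A) ?u) ?u)"
      by (simp add: Y_def op_selfadjD[OF saB])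
    also have "\<dots> \<le> norm (op_inv A) * Re (cinner (blinfun_apply B x) x)"
      using quadratic_form_le_norm[of "op_inv A" ?u] by (simp add: norm_op_sqrt_square[OF B])
    also have "\<dots> \<le> norm (op_inv A) * (norm B * (norm x)\<^sup>2)"
      by (intro mult_left_mono quadratic_form_le_norm) simp
    finally show ?thesis by (simp add: c_def kappa_def mult.assoc)
  qed
  moreover have c: "0 \<le> c" by (simp add: c_def kappa_def)
  ultimately have Y_le: "Re (cinner (blinfun_apply (op_sqrt Y) x) x) \<le> sqrt c * (norm x)\<^sup>2" for x
    by (rule quadratic_form_op_sqrt_le[OF Y])
  have G_eq: "A \<sharp> B = R o\<^sub>L op_sqrt X o\<^sub>L R" and P_eq: "A \<natural> B = R o\<^sub>L op_sqrt Y o\<^sub>L R"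
    by (simp_all add: geo_mean_def nat_mean_def X_def Y_def V_def R_def)
  have "op_nonneg (op_matrix (sqrt c *\<^sub>R (A \<sharp> B)) (A \<natural> B) (A \<natural> B) (sqrt c *\<^sub>R (A \<sharp> B)))"
  proof (rule op_matrix_nonneg)
    show "op_selfadj (sqrt c *\<^sub>R (A \<sharp> B))"
      unfolding G_eq
      by (intro op_selfadj_scaleR op_selfadj_conj saR op_nonneg_selfadj op_sqrt_nonneg X)
    show "op_nonneg (A \<natural> B)"
      unfolding P_eq by (intro op_nonneg_conj saR op_sqrt_nonneg Y)
    fix x
    \<comment> \<open>Both means have the form R Z R with \<open>R\<close> self-adjoint, so their
      forms at \<open>x\<close> are those of the inner roots at \<open>R x\<close>, where
      \<open>Y_le\<close> and \<open>X_ge\<close> meet at \<open>sqrt c\<close> times the squared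
      norm.\<close>
    let ?u = "blinfun_apply R x"
    have "Re (cinner (blinfun_apply (op_sqrt Y) ?u) ?u) \<le> sqrt c * (norm ?u)\<^sup>2" by (rule Y_le)
    also have "\<dots> \<le> sqrt c * Re (cinner (blinfun_apply (op_sqrt X) ?u) ?u)"
      using c by (intro mult_left_mono X_ge) simp
    finally show "Re (cinner (blinfun_apply (A \<natural> B) x) x)
        \<le> Re (cinner (blinfun_apply (sqrt c *\<^sub>R (A \<sharp> B)) x) x)"
      by (simp add: G_eq P_eq op_selfadjD[OF saR] blinfun.scaleR_left cinner_scaleR_left)
  qed
  then show ?thesis by (simp add: c_def)
qed

end
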